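(* For an odd integer $q\ge3$ let $E_q$ be the set of Erd\H{o}s functions mod $q$ and $V_q:=\{f\in E_q : L(1,f)=0\}$. Then \[ \lim_{x\to\infty}\frac{\sum_{3\le q\le x,\ q\text{ odd}}\# V_q}{\sum_{3\le q\le x,\ q\text{ odd}}\# E_q}=0 . \]
   Context: For an integer $q\ge1$, an Erd\H{o}s function mod $q$ is a rational-valued function $f$ on $\mathbb{Z}$, periodic with period $q$, such that $f(n)\in\{-1,1\}$ if $q\nmid n$, $f(n)=0$ if $q\mid n$, and $\sum_{a=1}^q f(a)=0$. Here $L(1,f)=\sum_{n=1}^\infty f(n)/n$, which converges because $\sum_{a=1}^q f(a)=0$. *)

theory Defs
  imports "HOL-Analysis.Analysis"
begin

definition erdos_function :: "nat \<Rightarrow> (int \<Rightarrow> rat) \<Rightarrow> bool" where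
  "erdos_function q f \<longleftrightarrow>
     (\<forall>n. f (n + int q) = f n) \<and>
     (\<forall>n. \<not> int q dvd n \<longrightarrow> f n \<in> {-1, 1}) \<and>
     (\<forall>n. int q dvd n \<longrightarrow> f n = 0) \<and>
     (\<Sum>a = 1..int q. f a) = 0"

(* The series is shifted to start at index 0; it is in general only conditionally
   convergent, so it is the limit of its partial sums in the natural order. *)
definition L1 :: "(int \<Rightarrow> rat) \<Rightarrow> real" where
  "L1 f = (\<Sum>n. real_of_rat (f (int (Suc n))) / real (Suc n))"

definition erdos_functions :: "nat \<Rightarrow> (int \<Rightarrow> rat) set" where
  "erdos_functions q = {f. erdos_function q f}"

definition vanishing_erdos_functions :: "nat \<Rightarrow> (int \<Rightarrow> rat) set" where
  "vanishing_erdos_functions q = {f \<in> erdos_functions q. L1 f = 0}"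

lemma erdos_function_mod:
  assumes "erdos_function q f"
  shows "f (n mod int q) = f n"
proof -
  have p: "f (m + int q) = f m" for m
    using assms by (simp add: erdos_function_def)
  have k: "f (m + int k * int q) = f m" for m k
  proof (induction k)
    case (Suc k)
    have "m + int (Suc k) * int q = (m + int k * int q) + int q"
      by (simp add: algebra_simps)
    then show ?case using p Suc by metis
  qed simp
  show ?thesis
  proof (cases "n div int q \<ge> 0")
    case True
    then show ?thesis
      using k[of "n mod int q" "nat (n div int q)"] by (simp add: mult.commute)
  next
    case False
    have "n + int (nat (- (n div int q))) * int q = n mod int q"
      using False by (simp add: algebra_simps minus_div_mult_eq_mod [symmetric])
    then show ?thesis
      using k[of n "nat (- (n div int q))"] by simp
  qed
qed

(* So card does not collapse to 0 on these sets or their subsets. *)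
lemma finite_erdos_functions:
  assumes "q \<ge> 1"
  shows "finite (erdos_functions q)"
proof (rule inj_on_finite)
  show "inj_on (\<lambda>f. restrict f {0..<int q}) (erdos_functions q)"
  proof (rule inj_onI, rule ext)
    fix f g n
    assume fg: "f \<in> erdos_functions q" "g \<in> erdos_functions q"
      "restrict f {0..<int q} = restrict g {0..<int q}"
    have "n mod int q \<in> {0..<int q}" using assms by simp
    then have "f (n mod int q) = g (n mod int q)" using fg(3) by (metis restrict_apply')
    then show "f n = g n" using fg(1,2) erdos_function_mod by (metis erdos_functions_def mem_Collect_eq)
  qed
  show "(\<lambda>f. restrict f {0..<int q}) ` erdos_functions q \<subseteq> {0..<int q} \<rightarrow>\<^sub>E {-1, 0, 1}"
  proof (rule image_subsetI, rule PiE_I)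
    fix f n
    assume f: "f \<in> erdos_functions q" and n: "n \<in> {0..<int q}"
    have "f n \<in> {-1, 0, 1}"
      using f by (cases "int q dvd n") (auto simp: erdos_functions_def erdos_function_def)
    then show "restrict f {0..<int q} n \<in> {-1, 0, 1}" using n by simp
  qed auto
  show "finite ({0..<int q} \<rightarrow>\<^sub>E {-1, 0, 1::rat})"
    by (intro finite_PiE) auto
qed

lemma summable_L1:
  assumes "erdos_function q f" and "q \<ge> 1"
  shows "summable (\<lambda>n. real_of_rat (f (int (Suc n))) / real (Suc n))"
proof -
  define g where "g n = real_of_rat (f (int (Suc n)))" for n
  define B where "B n = (\<Sum>k<n. g k)" for n
  have g_per: "g (n + q) = g n" for n
  proof -
    have "int (Suc (n + q)) = int (Suc n) + int q" by simp
    then show ?thesis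
      using assms(1) unfolding g_def erdos_function_def by metis
  qed
  have g_le: "\<bar>g n\<bar> \<le> 1" for n
    using assms(1) by (cases "int q dvd int (Suc n)") (auto simp: g_def erdos_function_def)
  have "(\<Sum>k<q. f (int (Suc k))) = (\<Sum>a = 1..int q. f a)"
    by (rule sum.reindex_bij_witness[where i = "\<lambda>a. nat a - 1" and j = "\<lambda>k. int (Suc k)"])
       auto
  then have "(\<Sum>k<q. f (int (Suc k))) = 0"
    using assms(1) by (simp only: erdos_function_def)
  then have Bq: "B q = 0"
    by (simp only: B_def g_def of_rat_sum [symmetric] of_rat_0)
  have B_per: "B (n + q) = B n" for n
  proof (induction n)
    case 0
    then show ?case using Bq by (simp add: B_def)
  next
    case (Suc n)
    then show ?case using g_per[of n] by (simp add: B_def)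
  qed
  have B_le: "\<bar>B n\<bar> \<le> real q" for n
  proof (induction n rule: less_induct)
    case (less n)
    show ?case
    proof (cases "n < q")
      case True
      have "\<bar>B n\<bar> \<le> (\<Sum>k<n. \<bar>g k\<bar>)" unfolding B_def by (rule sum_abs)
      also have "\<dots> \<le> (\<Sum>k<n. 1)" by (rule sum_mono) (rule g_le)
      finally show ?thesis using True by simp
    next
      case False
      then show ?thesis using less[of "n - q"] B_per[of "n - q"] assms(2) by simp
    qed
  qed
  define a where "a n = 1 / real (Suc n)" for n
  have a_lim: "a \<longlonglongrightarrow> 0"
    unfolding a_def using LIMSEQ_inverse_real_of_nat by (simp add: inverse_eq_divide)
  have Ba_lim: "(\<lambda>n. B n * a n) \<longlonglongrightarrow> 0"
  proof (rule Lim_null_comparison)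
    show "\<forall>\<^sub>F n in sequentially. norm (B n * a n) \<le> real q * a n"
      using B_le by (intro always_eventually allI)
        (auto simp: abs_mult a_def intro!: mult_right_mono divide_right_mono)
    show "(\<lambda>n. real q * a n) \<longlonglongrightarrow> 0"
      using tendsto_mult_right_zero[OF a_lim] by simp
  qed
  have s1: "summable (\<lambda>n. B (Suc n) * a (Suc n) - B n * a n)"
    by (rule telescope_summable[OF Ba_lim])
  have s2: "summable (\<lambda>n. B (Suc n) * (a n - a (Suc n)))"
  proof (rule summable_comparison_test')
    show "summable (\<lambda>n. real q * (a n - a (Suc n)))"
      by (intro summable_mult telescope_summable'[OF a_lim])
    have "a (Suc n) \<le> a n" for n by (simp add: a_def frac_le)
    then show "norm (B (Suc n) * (a n - a (Suc n))) \<le> real q * (a n - a (Suc n))"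
      if "n \<ge> 0" for n
      using B_le[of "Suc n"] by (simp add: abs_mult mult_right_mono)
  qed
  have "g n / real (Suc n) =
      (B (Suc n) * a (Suc n) - B n * a n) + B (Suc n) * (a n - a (Suc n))" for n
  proof -
    have "g n / real (Suc n) = (B (Suc n) - B n) * a n" by (simp add: B_def a_def)
    then show ?thesis by (simp add: algebra_simps)
  qed
  then show ?thesis
    using summable_add[OF s1 s2] by (simp add: g_def)
qed

end

(* Write q = 2m + 1. Since the values of f sum to 0, L(1,f) = -(1/q) * sum_{a<q} f(a) Digamma(a/q), and
   Digamma is strictly increasing, so L(1,f) is a linear form in the signs f(1), ..., f(2m) with
   distinct coefficients. Choose a perfect matching of {1, ..., 2m} uniformly at random and, independently,
   one element from each pair: the chosen set is a uniform m-subset, so the places where f = 1 can be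
   sampled this way. For a fixed matching the m choices change the linear form by nonzero amounts, and
   Littlewood-Offord (via Sperner) bounds the probability of the value 0 by C(m, m div 2) / 2^m,
   which tends to 0. *)

theory Submission
  imports Defs
begin

section \<open>Permutations, antichains and the Littlewood-Offord bound\<close>

text \<open>Symmetry: sorting the permutations of \<open>X\<close> by the image of \<open>R\<close>
  gives one class for each subset of size \<open>card R\<close>, and all classes are equally large,
  because composing with a permutation that carries \<open>S\<close> to \<open>S'\<close> injects
  the class of \<open>S\<close> into that of \<open>S'\<close>.\<close>

lemma card_permutes_image:
  assumes X: "finite X" and R: "R \<subseteq> X" and S: "S \<subseteq> X" and RS: "card R = card S"
  shows "card {p. p permutes X \<and> p ` R = S} * (card X choose card R) = fact (card X)"
proof -
  define N where "N S = {p. p permutes X \<and> p ` R = S}" for S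
  define B where "B = {S. S \<subseteq> X \<and> card S = card R}"
  have finP: "finite {p. p permutes X}" using X by (rule finite_permutations)
  have le: "card (N S) \<le> card (N S')" if "S \<in> B" "S' \<in> B" for S S'
  proof -
    have sub: "S \<subseteq> X" "S' \<subseteq> X" "card S = card S'" and fin: "finite S" "finite S'"
      using that X by (auto simp: B_def intro: finite_subset)
    obtain f where f: "bij_betw f S S'"
      using finite_same_card_bij[OF fin sub(3)] by blast
    obtain g where g: "bij_betw g (X - S) (X - S')"
    proof -
      have "card (X - S) = card (X - S')" using sub fin by (simp add: card_Diff_subset)
      then have "\<exists>g. bij_betw g (X - S) (X - S')" using X by (intro finite_same_card_bij) auto
      then show ?thesis using that by blast
    qed
    \<comment> \<open>Gluing a bijection from \<open>S\<close> to \<open>S'\<close> with one between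
      the complements gives a permutation of \<open>X\<close> that carries \<open>S\<close> to
      \<open>S'\<close>.\<close>
    define t where "t x = (if x \<in> S then f x else if x \<in> X then g x else x)" for x
    have t1: "bij_betw t S S'" using f by (rule bij_betw_cong[THEN iffD1, rotated]) (simp add: t_def)
    have t2: "bij_betw t (X - S) (X - S')"
      using g by (rule bij_betw_cong[THEN iffD1, rotated]) (simp add: t_def)
    have "bij_betw t (S \<union> (X - S)) (S' \<union> (X - S'))"
      by (rule bij_betw_combine[OF t1 t2]) auto
    moreover have "S \<union> (X - S) = X" "S' \<union> (X - S') = X" using sub by auto
    ultimately have tX: "t permutes X"
      using sub by (intro bij_imp_permutes) (auto simp: t_def)
    have tS: "t ` S = S'" using t1 by (simp add: bij_betw_def)
    show ?thesis
    proof (rule card_inj_on_le)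
      show "inj_on ((\<circ>) t) (N S)"
        using tX by (metis fun.inj_map inj_on_subset permutes_inj subset_UNIV)
      show "(\<circ>) t ` N S \<subseteq> N S'"
        using tX tS by (auto simp: N_def permutes_compose image_comp [symmetric])
      show "finite (N S')" using finP by (simp add: N_def)
    qed
  qed
  have SB: "S \<in> B" using S RS by (simp add: B_def)
  have eq: "card (N S') = card (N S)" if "S' \<in> B" for S'
    using le SB that by (meson le_antisym)
  have finB: "finite B" using X by (simp add: B_def)
  have "{p. p permutes X} = (\<Union>S'\<in>B. N S')"
  proof -
    have "p ` R \<in> B" if "p permutes X" for p
      using that R permutes_in_image[OF that] permutes_inj_on[OF that]
      by (auto simp: B_def card_image)
    then show ?thesis by (auto simp: N_def)
  qed
  then have "fact (card X) = card (\<Union>S'\<in>B. N S')"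
    using card_permutations[OF refl X] by simp
  also have "\<dots> = (\<Sum>S'\<in>B. card (N S'))"
    using finB finP by (intro card_UN_disjoint) (auto simp: N_def)
  also have "\<dots> = card B * card (N S)" using eq by simp
  also have "card B = card X choose card R" using n_subsets[OF X] by (simp add: B_def)
  finally show ?thesis by (simp add: N_def mult.commute)
qed

(* Counts maximal chains: the permutation p encodes the chain of the sets p ` {..<k}, which
   meets an antichain at most once. *)
lemma sperner:
  fixes n :: nat
  assumes V: "V \<subseteq> Pow {..<n}"
    and anti: "\<And>S T. S \<in> V \<Longrightarrow> T \<in> V \<Longrightarrow> S \<subseteq> T \<Longrightarrow> S = T"
  shows "card V \<le> n choose (n div 2)"
proof -
  let ?X = "{..<n}"
  define N where "N S = {p. p permutes ?X \<and> p ` {..<card S} = S}" for S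
  have fin: "finite {p. p permutes ?X}" by (simp add: finite_permutations)
  have finV: "finite V" using V finite_subset by blast
  have "card V * fact n = (\<Sum>S\<in>V. fact n)" by simp
  also have "\<dots> \<le> (\<Sum>S\<in>V. card (N S) * (n choose (n div 2)))"
  proof (rule sum_mono)
    fix S assume "S \<in> V"
    then have S: "S \<subseteq> ?X" using V by auto
    then have "card S \<le> n" using card_mono[of ?X S] by simp
    \<comment> \<open>The chains through \<open>S\<close> number n! divided by a binomial
      coefficient, and the middle coefficient is the largest; this is the LYM inequality in integer
      form.\<close>
    then have "card (N S) * (n choose card S) = fact n"
      using card_permutes_image[of ?X "{..<card S}" S] S by (simp add: N_def)
    then show "fact n \<le> card (N S) * (n choose (n div 2))"
      by (metis binomial_maximum mult_le_mono2)
  qed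
  also have "\<dots> = card (\<Union>S\<in>V. N S) * (n choose (n div 2))"
  proof -
    have "N S \<inter> N T = {}" if "S \<in> V" "T \<in> V" "S \<noteq> T" for S T
    proof (rule ccontr)
      assume "N S \<inter> N T \<noteq> {}"
      then obtain p where p: "p ` {..<card S} = S" "p ` {..<card T} = T" by (auto simp: N_def)
      have "S \<subseteq> T \<or> T \<subseteq> S"
      proof (cases "card S \<le> card T")
        case True
        then have "p ` {..<card S} \<subseteq> p ` {..<card T}" by (intro image_mono) auto
        then show ?thesis using p by simp
      next
        case False
        then have "p ` {..<card T} \<subseteq> p ` {..<card S}" by (intro image_mono) auto
        then show ?thesis using p by simp
      qed
      then show False using that anti by blast
    qed
    then have "card (\<Union>S\<in>V. N S) = (\<Sum>S\<in>V. card (N S))"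
      using finV fin by (intro card_UN_disjoint) (auto simp: N_def)
    then show ?thesis by (simp add: sum_distrib_right)
  qed
  also have "card (\<Union>S\<in>V. N S) \<le> card {p. p permutes ?X}"
    using fin by (intro card_mono) (auto simp: N_def)
  also have "card {p. p permutes ?X} = fact n" by (simp add: card_permutations)
  finally show ?thesis by (simp add: mult.commute)
qed

text \<open>Erdos's argument: with positive weights a proper superset has a strictly larger sum, so
  the sets with a prescribed sum form an antichain and Sperner's bound applies.\<close>

lemma littlewood_offord:
  fixes d :: "nat \<Rightarrow> real"
  assumes d: "\<And>j. j < n \<Longrightarrow> d j \<noteq> 0"
  shows "card {T. T \<subseteq> {..<n} \<and> sum d T = t} \<le> n choose (n div 2)"
proof -
  define M where "M = {j. j < n \<and> d j < 0}"
  (* Taking the symmetric difference with M makes all weights positive. *)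
  define F where "F T = (T - M) \<union> (M - T)" for T
  let ?W = "{T. T \<subseteq> {..<n} \<and> sum d T = t}"
  have FF: "F (F T) = T" for T by (auto simp: F_def)
  \<comment> \<open>The flip by \<open>M\<close> changes the sum only by the constant
    \<open>sum d M\<close>, so sets of equal sum go to sets of equal absolute weight.\<close>
  have key: "sum d T = (\<Sum>j\<in>F T. \<bar>d j\<bar>) + sum d M" if T: "T \<subseteq> {..<n}" for T
  proof -
    have fT: "finite T" "finite M" using T finite_subset by (auto simp: M_def)
    have "(\<Sum>j\<in>F T. \<bar>d j\<bar>) = (\<Sum>j\<in>T - M. \<bar>d j\<bar>) + (\<Sum>j\<in>M - T. \<bar>d j\<bar>)"
      unfolding F_def using fT by (intro sum.union_disjoint) auto
    also have "(\<Sum>j\<in>T - M. \<bar>d j\<bar>) = sum d (T - M)"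
      using T by (intro sum.cong) (auto simp: M_def)
    also have "(\<Sum>j\<in>M - T. \<bar>d j\<bar>) = - sum d (M - T)"
      by (simp add: M_def sum_negf [symmetric])
    finally show ?thesis
      using fT sum.Int_Diff[of T d M] sum.Int_Diff[of M d T] by (simp add: Int_commute)
  qed
  have "card ?W = card (F ` ?W)"
    by (rule card_image [symmetric], rule inj_on_inverseI, rule FF)
  also have "\<dots> \<le> n choose (n div 2)"
  proof (rule sperner)
    show "F ` ?W \<subseteq> Pow {..<n}" by (auto simp: F_def M_def)
  next
    fix S T assume ST: "S \<in> F ` ?W" "T \<in> F ` ?W" and sub: "S \<subseteq> T"
    have val: "(\<Sum>j\<in>U. \<bar>d j\<bar>) = t - sum d M" "U \<subseteq> {..<n}" if "U \<in> F ` ?W" for U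
      using that key by (auto simp: F_def M_def)
    have fT: "finite T" using val(2)[OF ST(2)] finite_subset by blast
    \<comment> \<open>Nested sets of equal weight differ by a set of weight 0, which is empty as no
      \<open>d j\<close> vanishes.\<close>
    have "(\<Sum>j\<in>T - S. \<bar>d j\<bar>) = 0"
      using sum_diff[OF fT sub, of "\<lambda>j. \<bar>d j\<bar>"] val[OF ST(1)] val[OF ST(2)] by simp
    then have "\<forall>j\<in>T - S. d j = 0" using fT by (simp add: sum_nonneg_eq_0_iff)
    then have "T - S = {}" using d val(2)[OF ST(2)] by blast
    then show "S = T" using sub by blast
  qed
  finally show ?thesis .
qed

section \<open>Half-size subsets with a prescribed sum\<close>

text \<open>Double counting of the pairs of a permutation \<open>p\<close> and a switch set
  \<open>T\<close> for which the selected set has sum \<open>t\<close>. For fixed \<open>T\<close>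
  the number of \<open>p\<close> is \<open>N\<close>, whatever \<open>T\<close> is; for fixed
  \<open>p\<close> Littlewood-Offord bounds the number of \<open>T\<close>.\<close>

lemma card_equal_halves_sum_le:
  fixes w :: "nat \<Rightarrow> real"
  assumes w: "inj_on w {..<2*m}"
  shows "card {S. S \<subseteq> {..<2*m} \<and> card S = m \<and> sum w S = t} * 2 ^ m
           \<le> (2*m choose m) * (m choose (m div 2))"
proof -
  let ?X = "{..<2*m}" and ?R = "{..<m}"
  define P where "P = {p. p permutes ?X}"
  define V where "V = {S. S \<subseteq> ?X \<and> card S = m \<and> sum w S = t}"
  (* The permutation p encodes the matching of p j with p (j + m), and r T switches the choice
     in the pairs with j in T. *)
  define r where "r T x = (if x < m \<and> x \<in> T then x + m
      else if m \<le> x \<and> x < 2*m \<and> x - m \<in> T then x - m else x)" for T and x :: nat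
  have finP: "finite P" by (simp add: P_def finite_permutations)
  have cardP: "card P = fact (2*m)" by (simp add: P_def card_permutations)
  have finV: "finite V" by (simp add: V_def)
  define N where "N = card {p \<in> P. sum w (p ` ?R) = t}"
  have rr: "r T (r T x) = x" if "T \<subseteq> ?R" for T x using that by (auto simp: r_def)
  have rP: "r T \<in> P" if T: "T \<subseteq> ?R" for T
  proof -
    have "bij_betw (r T) ?X ?X"
      by (rule bij_betw_byWitness[where f' = "r T"]) (use rr[OF T] in \<open>auto simp: r_def\<close>)
    then show ?thesis unfolding P_def mem_Collect_eq
      by (rule bij_imp_permutes) (auto simp: r_def)
  qed
  \<comment> \<open>Since \<open>r T\<close> is an involution, composing with it permutes
    \<open>P\<close>, which makes the count independent of \<open>T\<close>.\<close>
  have N_T: "card {p \<in> P. sum w ((p \<circ> r T) ` ?R) = t} = N" if T: "T \<subseteq> ?R" for T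
    unfolding N_def
  proof (rule bij_betw_same_card[where f = "\<lambda>p. p \<circ> r T"], rule bij_betw_byWitness[where f' = "\<lambda>p. p \<circ> r T"])
    have c: "p \<circ> r T \<circ> r T = p" for p using rr[OF T] by auto
    show "\<forall>p\<in>{p \<in> P. sum w ((p \<circ> r T) ` ?R) = t}. p \<circ> r T \<circ> r T = p"
      "\<forall>p\<in>{p \<in> P. sum w (p ` ?R) = t}. p \<circ> r T \<circ> r T = p" using c by auto
    have Pc: "p \<circ> r T \<in> P" if "p \<in> P" for p
      using that rP[OF T] by (simp add: P_def permutes_compose)
    show "(\<lambda>p. p \<circ> r T) ` {p \<in> P. sum w ((p \<circ> r T) ` ?R) = t} \<subseteq> {p \<in> P. sum w (p ` ?R) = t}"
      using Pc by auto
    show "(\<lambda>p. p \<circ> r T) ` {p \<in> P. sum w (p ` ?R) = t} \<subseteq> {p \<in> P. sum w ((p \<circ> r T) ` ?R) = t}"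
      using Pc by (auto simp: rr[OF T])
  qed
  \<comment> \<open>Under a uniform permutation the image of \<open>?R\<close> is a uniform
    m-subset, so \<open>N\<close> is to (2m)! as \<open>card V\<close> is to the number of
    m-subsets.\<close>
  have "{p \<in> P. sum w (p ` ?R) = t} = (\<Union>S\<in>V. {p. p permutes ?X \<and> p ` ?R = S})"
  proof -
    have "p ` ?R \<subseteq> ?X \<and> card (p ` ?R) = m" if "p permutes ?X" for p
      using permutes_in_image[OF that] permutes_inj_on[OF that] by (auto simp: card_image)
    then show ?thesis by (auto simp: P_def V_def)
  qed
  then have "N = card (\<Union>S\<in>V. {p. p permutes ?X \<and> p ` ?R = S})" by (simp add: N_def)
  also have "\<dots> = (\<Sum>S\<in>V. card {p. p permutes ?X \<and> p ` ?R = S})"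
    using finV finP by (intro card_UN_disjoint) (auto simp: P_def)
  finally have "N * (2*m choose m) = (\<Sum>S\<in>V. card {p. p permutes ?X \<and> p ` ?R = S} * (2*m choose m))"
    by (simp add: sum_distrib_right)
  also have "\<dots> = (\<Sum>S\<in>V. fact (2*m))"
  proof (rule sum.cong)
    fix S assume "S \<in> V"
    then show "card {p. p permutes ?X \<and> p ` ?R = S} * (2*m choose m) = fact (2*m)"
      using card_permutes_image[of ?X ?R S] by (simp add: V_def)
  qed simp
  finally have NV: "N * (2*m choose m) = card V * fact (2*m)" by simp
  have "2 ^ m * N = (\<Sum>T\<in>Pow ?R. card {p \<in> P. sum w ((p \<circ> r T) ` ?R) = t})"
    using N_T by (simp add: card_Pow)
  also have "\<dots> = (\<Sum>T\<in>Pow ?R. \<Sum>p\<in>P. if sum w ((p \<circ> r T) ` ?R) = t then 1 else 0)"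
    using finP by (simp add: sum.If_cases Int_def)
  also have "\<dots> = (\<Sum>p\<in>P. \<Sum>T\<in>Pow ?R. if sum w ((p \<circ> r T) ` ?R) = t then 1 else 0)"
    by (rule sum.swap)
  also have "\<dots> = (\<Sum>p\<in>P. card {T \<in> Pow ?R. sum w ((p \<circ> r T) ` ?R) = t})"
    by (simp add: sum.If_cases Int_def)
  also have "\<dots> \<le> (\<Sum>p\<in>P. m choose (m div 2))"
  proof (rule sum_mono)
    fix p assume "p \<in> P"
    then have p: "p permutes ?X" by (simp add: P_def)
    \<comment> \<open>The change in the sum when pair \<open>j\<close> is switched; it is nonzero
      since \<open>w\<close> and \<open>p\<close> are injective.\<close>
    define d where "d j = w (p (j + m)) - w (p j)" for j
    have val: "sum w ((p \<circ> r T) ` ?R) = (\<Sum>j<m. w (p j)) + sum d T" if T: "T \<subseteq> ?R" for T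
    proof -
      have "inj (p \<circ> r T)"
        using permutes_inj[OF p] permutes_inj[of "r T" ?X] rP[OF T] by (simp add: P_def inj_compose)
      then have "sum w ((p \<circ> r T) ` ?R) = (\<Sum>j<m. w (p (r T j)))"
        by (subst sum.reindex) (auto intro: inj_on_subset)
      also have "\<dots> = (\<Sum>j<m. w (p j) + (if j \<in> T then d j else 0))"
        by (intro sum.cong) (auto simp: r_def d_def)
      also have "\<dots> = (\<Sum>j<m. w (p j)) + (\<Sum>j\<in>?R \<inter> T. d j)"
        by (simp add: sum.distrib sum.inter_restrict)
      finally show ?thesis using T by (simp add: Int_absorb1)
    qed
    have "d j \<noteq> 0" if j: "j < m" for j
    proof -
      have "p (j + m) \<noteq> p j" using permutes_inj[OF p] j by (simp add: inj_eq)
      moreover have "p (j + m) \<in> ?X" "p j \<in> ?X" using permutes_in_image[OF p] j by simp_all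
      ultimately show ?thesis using w by (simp add: d_def inj_on_eq_iff)
    qed
    then have "card {T. T \<subseteq> ?R \<and> sum d T = t - (\<Sum>j<m. w (p j))} \<le> m choose (m div 2)"
      by (rule littlewood_offord)
    moreover have "{T \<in> Pow ?R. sum w ((p \<circ> r T) ` ?R) = t}
        = {T. T \<subseteq> ?R \<and> sum d T = t - (\<Sum>j<m. w (p j))}"
      using val by (intro Collect_cong) (auto simp del: comp_apply)
    ultimately show "card {T \<in> Pow ?R. sum w ((p \<circ> r T) ` ?R) = t} \<le> m choose (m div 2)" by simp
  qed
  finally have "2 ^ m * N \<le> fact (2*m) * (m choose (m div 2))" using cardP by simp
  moreover have "fact (2*m) * (card V * 2 ^ m) = 2 ^ m * N * (2*m choose m)"
    unfolding mult.assoc NV by (simp only: mult_ac)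
  ultimately have "fact (2*m) * (card V * 2 ^ m)
      \<le> fact (2*m) * (m choose (m div 2)) * (2*m choose m)"
    by (metis mult_le_mono1)
  also have "\<dots> = fact (2*m) * ((2*m choose m) * (m choose (m div 2)))" by (simp only: mult_ac)
  finally have "card V * 2 ^ m \<le> (2*m choose m) * (m choose (m div 2))"
    by (simp only: nat_mult_le_cancel1 fact_gt_zero)
  then show ?thesis by (simp add: V_def)
qed

section \<open>Decay of the middle binomial coefficient\<close>

text \<open>The factor \<open>2*k+1\<close> is what makes the induction close: consecutive central
  coefficients have ratio 2(2k+1)/(k+1). Taking square roots yields a bound of order 1/sqrt(k)
  relative to 4^k.\<close>

lemma central_binomial_square_le: "(2*k choose k)\<^sup>2 * (2*k+1) \<le> 16 ^ k"
proof (induction k)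
  case (Suc k)
  let ?c = "2*k choose k" and ?d = "2 * Suc k choose Suc k"
  have "Suc k * ?d = 2 * (2*k+1) * ?c"
  proof -
    have "Suc k * ?d = 2 * Suc k * ((2*k+1) choose k)"
      using Suc_times_binomial_eq[of "2*k+1" k] by (simp add: algebra_simps)
    moreover have "Suc k * ((2*k+1) choose k) = (2*k+1) * ?c"
      using binomial_absorb_comp[of "2*k+1" k] by simp
    ultimately show ?thesis by (simp add: algebra_simps)
  qed
  then have "(Suc k)\<^sup>2 * (?d\<^sup>2 * (2*k+3)) = (2 * (2*k+1) * ?c)\<^sup>2 * (2*k+3)"
    by (metis mult.assoc power_mult_distrib)
  also have "\<dots> = 4 * (2*k+1) * (2*k+3) * (?c\<^sup>2 * (2*k+1))"
    by (simp add: power2_eq_square algebra_simps)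
  also have "\<dots> \<le> 4 * (2*k+1) * (2*k+3) * 16 ^ k"
    using Suc.IH by (intro mult_le_mono2)
  \<comment> \<open>This is (2k+1)(2k+3) = 4(k+1)^2 - 1.\<close>
  also have "\<dots> \<le> (16 * (Suc k)\<^sup>2) * 16 ^ k"
    by (intro mult_le_mono1) (simp add: power2_eq_square algebra_simps)
  also have "\<dots> = (Suc k)\<^sup>2 * 16 ^ Suc k" by (simp only: power_Suc mult_ac)
  finally have "?d\<^sup>2 * (2*k+3) \<le> 16 ^ Suc k"
    by (simp only: nat_mult_le_cancel1 zero_less_power zero_less_Suc)
  moreover have "2 * Suc k + 1 = 2*k+3" by simp
  ultimately show ?case by (simp only:)
qed simp

lemma middle_binomial_div_power_tendsto_0:
  "(\<lambda>m. real (m choose (m div 2)) / 2 ^ m) \<longlonglongrightarrow> 0"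
proof -
  have "real (m choose (m div 2)) / 2 ^ m \<le> 1 / sqrt (real m)" if "m > 0" for m
  proof -
    define k where "k = m div 2"
    have "(2*k choose k) / 4 ^ k \<le> 1 / sqrt (2*k+1)"
    proof (rule power2_le_imp_le)
      have "real ((2*k choose k)\<^sup>2 * (2*k+1)) \<le> real (16 ^ k)"
        using central_binomial_square_le by (rule of_nat_mono)
      moreover have "(4 ^ k)\<^sup>2 = (16::real) ^ k" by (simp add: power2_eq_square power_mult_distrib [symmetric])
      ultimately show "((2*k choose k) / 4 ^ k)\<^sup>2 \<le> (1 / sqrt (2*k+1))\<^sup>2"
        by (simp add: power_divide field_simps)
    qed simp
    also have "\<dots> \<le> 1 / sqrt (real m)"
      using that by (intro divide_left_mono) (auto simp: k_def)
    finally have le: "(2*k choose k) / 4 ^ k \<le> 1 / sqrt (real m)" .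
    show ?thesis
    proof (cases "even m")
      case True
      then have "m = 2 * k" by (simp add: k_def)
      then show ?thesis using le by (simp add: power_mult)
    next
      case False
      then have m: "m = Suc (2 * k)" by (simp add: k_def)
      \<comment> \<open>By Pascal's rule the coefficient at most doubles from 2k to 2k+1, while the
        power of 2 doubles exactly, so the even bound carries over.\<close>
      have "Suc (2*k) choose k \<le> 2 * (2*k choose k)"
      proof (cases k)
        case (Suc l)
        have "2*k choose l \<le> 2*k choose k" using binomial_maximum'[of k l] by simp
        then show ?thesis using Suc by simp
      qed simp
      then have "real (m choose k) / 2 ^ m \<le> real (2 * (2*k choose k)) / 2 ^ m"
        using m by (intro divide_right_mono of_nat_mono) auto
      also have "\<dots> = (2*k choose k) / 4 ^ k" by (simp add: m power_mult)
      finally show ?thesis using le by (simp add: k_def)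
    qed
  qed
  then have ev: "\<forall>\<^sub>F m in sequentially. norm (real (m choose (m div 2)) / 2 ^ m) \<le> 1 / sqrt (real m)"
    by (intro eventually_sequentiallyI[of 1]) auto
  have "(\<lambda>m. 1 / sqrt (real m)) \<longlonglongrightarrow> 0"
    by (intro tendsto_divide_0[OF tendsto_const] filterlim_at_top_imp_at_infinity
        filterlim_compose[OF sqrt_at_top filterlim_real_sequentially])
  with ev show ?thesis by (rule Lim_null_comparison)
qed

section \<open>From pointwise ratios to ratios of sums\<close>

text \<open>A Stolz-Cesaro argument: the quotient is at most a weighted mean of
  \<open>\<epsilon>\<close>, and the total weight diverges, so the finitely many early terms are
  negligible.\<close>

lemma sum_ratio_tendsto_0:
  fixes v e \<epsilon> :: "nat \<Rightarrow> real"
  assumes v: "\<And>q. q \<in> Q \<Longrightarrow> 0 \<le> v q" "\<And>q. q \<in> Q \<Longrightarrow> v q \<le> \<epsilon> q * e q"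
    and e: "\<And>q. q \<in> Q \<Longrightarrow> 1 \<le> e q"
    and \<epsilon>: "\<epsilon> \<longlonglongrightarrow> 0" and Q: "infinite Q"
  shows "((\<lambda>x::real. (\<Sum>q | q \<in> Q \<and> real q \<le> x. v q) / (\<Sum>q | q \<in> Q \<and> real q \<le> x. e q))
           \<longlongrightarrow> 0) at_top"
proof -
  define A where "A x = {q \<in> Q. real q \<le> x}" for x
  have finA: "finite (A x)" for x
    by (rule finite_subset[of _ "{..nat \<lfloor>x\<rfloor>}"]) (auto simp: A_def le_nat_floor)
  have big: "\<exists>x0. \<forall>x\<ge>x0. C \<le> (\<Sum>q\<in>A x. e q)" for C
  proof -
    obtain B where B: "B \<subseteq> Q" "finite B" "card B = nat \<lceil>C\<rceil>"
      using infinite_arbitrarily_large[OF Q] by blast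
    show ?thesis
    proof (intro exI allI impI)
      \<comment> \<open>Inserting 0 keeps \<open>Max\<close> meaningful when \<open>B\<close> is
        empty, which happens for \<open>C\<close> at most 0.\<close>
      fix x assume x: "x \<ge> real (Max (insert 0 B))"
      have "C \<le> real (card B)" using B by linarith
      also have "\<dots> = (\<Sum>q\<in>B. 1)" by simp
      also have "\<dots> \<le> (\<Sum>q\<in>B. e q)" using B e by (intro sum_mono) auto
      also have "\<dots> \<le> (\<Sum>q\<in>A x. e q)"
      proof (rule sum_mono2[OF finA])
        have "real q \<le> x" if "q \<in> B" for q
        proof -
          have "q \<le> Max (insert 0 B)" using that B by (intro Max_ge) auto
          then show ?thesis using x by linarith
        qed
        then show "B \<subseteq> A x" using B by (auto simp: A_def)
        show "0 \<le> e q" if "q \<in> A x - B" for q using that e[of q] by (auto simp: A_def)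
      qed
      finally show "C \<le> (\<Sum>q\<in>A x. e q)" .
    qed
  qed
  have "((\<lambda>x. (\<Sum>q\<in>A x. v q) / (\<Sum>q\<in>A x. e q)) \<longlongrightarrow> 0) at_top"
  proof (rule tendstoI)
    fix r :: real assume r: "r > 0"
    have "\<forall>\<^sub>F q in sequentially. \<epsilon> q < r / 2"
      using order_tendstoD(2)[OF \<epsilon>, of "r/2"] r by simp
    then obtain q0 where q0: "\<And>q. q \<ge> q0 \<Longrightarrow> \<epsilon> q < r / 2"
      by (auto simp: eventually_sequentially)
    define K where "K = (\<Sum>q\<in>Q \<inter> {..<q0}. v q)"
    have K: "0 \<le> K" unfolding K_def using v(1) by (intro sum_nonneg) auto
    \<comment> \<open>The threshold makes the early part \<open>K\<close> less than
      \<open>r / 2\<close> times the denominator; the added 1 makes this strict and the denominator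
      positive. The terms from \<open>q0\<close> on supply the other half of
      \<open>r\<close>.\<close>
    obtain x0 where x0: "\<And>x. x \<ge> x0 \<Longrightarrow> 2 * K / r + 1 \<le> (\<Sum>q\<in>A x. e q)"
      using big by blast
    show "\<forall>\<^sub>F x in at_top. dist ((\<Sum>q\<in>A x. v q) / (\<Sum>q\<in>A x. e q)) 0 < r"
    proof (rule eventually_at_top_linorderI)
      fix x assume "x \<ge> x0"
      define E where "E = (\<Sum>q\<in>A x. e q)"
      have E: "2 * K / r + 1 \<le> E" using x0 \<open>x \<ge> x0\<close> by (simp add: E_def)
      then have KE: "K < r / 2 * E" using r by (simp add: field_simps)
      have Epos: "E > 0"
      proof -
        have "0 \<le> 2 * K / r" using K r by simp
        then show ?thesis using E by linarith
      qed
      have pos: "0 \<le> (\<Sum>q\<in>A x. v q)" using v(1) by (intro sum_nonneg) (auto simp: A_def)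
      have "(\<Sum>q\<in>A x. v q) \<le> (\<Sum>q\<in>A x. (if q < q0 then v q else 0) + r / 2 * e q)"
      proof (rule sum_mono)
        fix q assume "q \<in> A x"
        then have q: "q \<in> Q" by (simp add: A_def)
        show "v q \<le> (if q < q0 then v q else 0) + r / 2 * e q"
        proof (cases "q < q0")
          case True
          then show ?thesis using e[OF q] r by simp
        next
          case False
          then have "\<epsilon> q * e q \<le> r / 2 * e q"
            using q0[of q] e[OF q] by (intro mult_right_mono) auto
          then show ?thesis using v(2)[OF q] False by simp
        qed
      qed
      also have "\<dots> = (\<Sum>q\<in>A x. if q < q0 then v q else 0) + r / 2 * E"
        by (simp add: sum.distrib sum_distrib_left E_def)
      also have "(\<Sum>q\<in>A x. if q < q0 then v q else 0) = (\<Sum>q\<in>A x \<inter> {..<q0}. v q)"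
        using finA by (simp add: sum.inter_restrict)
      also have "\<dots> \<le> K"
        unfolding K_def using v(1) by (intro sum_mono2) (auto simp: A_def)
      finally have "(\<Sum>q\<in>A x. v q) < r * E" using KE by simp
      then show "dist ((\<Sum>q\<in>A x. v q) / (\<Sum>q\<in>A x. e q)) 0 < r"
        using pos Epos unfolding E_def [symmetric] by (simp add: field_simps)
    qed
  qed
  then show ?thesis by (simp add: A_def)
qed

section \<open>L(1,f) as a linear form in Digamma values\<close>

lemma sum_erdos_function:
  assumes "erdos_function q f"
  shows "(\<Sum>k<q. f (int (Suc k))) = 0"
proof -
  have "(\<Sum>k<q. f (int (Suc k))) = (\<Sum>a = 1..int q. f a)"
    by (rule sum.reindex_bij_witness[where i = "\<lambda>a. nat a - 1" and j = "\<lambda>k. int (Suc k)"]) auto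
  then show ?thesis using assms by (simp only: erdos_function_def)
qed

text \<open>Summing the series in blocks of length \<open>q\<close> and sorting by residue turns
  each residue class into a truncated Digamma series. The harmonic terms and Euler's constant do not
  depend on the residue, so they cancel because \<open>f\<close> sums to 0 over a period.\<close>

lemma L1_eq_sum_Digamma:
  assumes f: "erdos_function q f" and q: "q \<ge> 1"
  shows "L1 f = - (\<Sum>a<q. real_of_rat (f (int (Suc a))) * Digamma (real (Suc a) / real q)) / real q"
proof -
  define g where "g n = real_of_rat (f (int (Suc n)))" for n
  have g_per: "g (n + q) = g n" for n
  proof -
    have "int (Suc (n + q)) = int (Suc n) + int q" by simp
    then show ?thesis using f unfolding g_def erdos_function_def by metis
  qed
  have g_per': "g (n + k * q) = g n" for n k
  proof (induction k)
    case (Suc k)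
    have "g (n + Suc k * q) = g (n + k * q + q)" by (simp add: algebra_simps)
    then show ?case using g_per Suc by simp
  qed simp
  have "(\<Sum>k<q. f (int (Suc k))) = 0" using f by (rule sum_erdos_function)
  then have g0: "(\<Sum>a<q. g a) = 0" by (simp only: g_def of_rat_sum [symmetric] of_rat_0)
  \<comment> \<open>The terms of the series for Digamma(z) plus Euler's constant at z = (a+1)/q;
    index \<open>a\<close> stands for the residue a+1.\<close>
  define D where "D a = (\<lambda>k. inverse (real (Suc k)) - inverse (real (Suc a) / real q + real k))" for a
  have D: "D a sums (Digamma (real (Suc a) / real q) + euler_mascheroni)" if "a < q" for a
  proof -
    have "summable (D a)" unfolding D_def using q by (intro summable_Digamma) auto
    then show ?thesis unfolding D_def by (simp add: Digamma_def summable_sums)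
  qed
  have block: "(\<Sum>n<N * q. g n / real (Suc n)) = - (\<Sum>a<q. g a * (\<Sum>k<N. D a k)) / real q" for N
  proof -
    have "(\<Sum>n<N * q. g n / real (Suc n)) = (\<Sum>k<N. \<Sum>n\<in>{k * q..<k * q + q}. g n / real (Suc n))"
      by (rule sum.nat_group [symmetric])
    also have "\<dots> = (\<Sum>k<N. \<Sum>a<q. g a / real (Suc (a + k * q)))"
    proof (rule sum.cong)
      fix k
      have "(\<Sum>n\<in>{k * q..<k * q + q}. g n / real (Suc n))
          = (\<Sum>a<q. g (a + k * q) / real (Suc (a + k * q)))"
        using sum.shift_bounds_nat_ivl[of "\<lambda>n. g n / real (Suc n)" 0 "k * q" q]
        by (simp add: add.commute lessThan_atLeast0)
      then show "(\<Sum>n\<in>{k * q..<k * q + q}. g n / real (Suc n))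
          = (\<Sum>a<q. g a / real (Suc (a + k * q)))" by (simp add: g_per')
    qed simp
    also have "\<dots> = (\<Sum>k<N. - (\<Sum>a<q. g a * D a k) / real q)"
    proof (rule sum.cong)
      fix k
      have D1: "g a / real (Suc (a + k * q)) = g a * inverse (real (Suc k)) / real q - g a * D a k / real q" for a
      proof -
        have "real (Suc a) / real q + real k = real (Suc (a + k * q)) / real q"
          using q by (simp add: field_simps)
        then have "inverse (real (Suc a) / real q + real k) = real q / real (Suc (a + k * q))"
          by simp
        then show ?thesis unfolding D_def using q by (simp add: divide_simps right_diff_distrib)
      qed
      show "(\<Sum>a<q. g a / real (Suc (a + k * q))) = - (\<Sum>a<q. g a * D a k) / real q"
        unfolding D1 sum_subtractf
        by (simp add: g0 sum_divide_distrib [symmetric] sum_distrib_right [symmetric])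
    qed simp
    also have "\<dots> = - (\<Sum>a<q. g a * (\<Sum>k<N. D a k)) / real q"
      by (simp add: sum_divide_distrib [symmetric] sum_negf sum_distrib_left sum.swap[of _ "{..<q}"])
    finally show ?thesis .
  qed
  have lim: "(\<lambda>N. \<Sum>n<N * q. g n / real (Suc n)) \<longlonglongrightarrow>
      - (\<Sum>a<q. g a * (Digamma (real (Suc a) / real q) + euler_mascheroni)) / real q"
    unfolding block using D q by (intro tendsto_intros) (auto simp: sums_def)
  have shift: "(\<Sum>a<q. g a * (Digamma (real (Suc a) / real q) + euler_mascheroni))
      = (\<Sum>a<q. g a * Digamma (real (Suc a) / real q))"
    by (simp add: distrib_left sum.distrib sum_distrib_right [symmetric] g0)
  \<comment> \<open>The block sums are a subsequence of the partial sums, which converge by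
    \<open>summable_L1\<close>.\<close>
  have "(\<lambda>N. \<Sum>n<N * q. g n / real (Suc n)) \<longlonglongrightarrow> L1 f"
  proof -
    have "(\<lambda>n. g n / real (Suc n)) sums L1 f"
      using summable_L1[OF f q] unfolding L1_def g_def by (rule summable_sums)
    moreover have "filterlim (\<lambda>N. N * q) at_top sequentially"
      using q by (intro filterlim_subseq strict_monoI) simp
    ultimately show ?thesis unfolding sums_def by (rule filterlim_compose)
  qed
  from LIMSEQ_unique[OF this lim] show ?thesis by (simp only: shift) (simp only: g_def)
qed

section \<open>Erdos functions as half-size subsets\<close>

lemma erdos_function_at_multiple: "erdos_function q f \<Longrightarrow> int q dvd n \<Longrightarrow> f n = 0"
  by (simp add: erdos_function_def)

lemma erdos_function_at_nonmultiple:
  "erdos_function q f \<Longrightarrow> \<not> int q dvd n \<Longrightarrow> f n = 1 \<or> f n = -1"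
  by (auto simp: erdos_function_def)

lemma not_dvd_below: "i < 2*m \<Longrightarrow> \<not> int (Suc (2*m)) dvd int (Suc i)"
  by (simp only: int_dvd_int_iff) (auto dest: dvd_imp_le)

text \<open>A function is encoded by the places where it is 1. Mean zero forces this set to have
  \<open>m\<close> elements, and a vanishing linear form forces it to carry exactly half of the
  total weight.\<close>

lemma card_vanishing_erdos_functions_le:
  fixes m :: nat
  defines "w \<equiv> \<lambda>i. Digamma (real (Suc i) / real (Suc (2*m)))"
  shows "card (vanishing_erdos_functions (Suc (2*m)))
    \<le> card {S. S \<subseteq> {..<2*m} \<and> card S = m \<and> sum w S = (\<Sum>i<2*m. w i) / 2}"
proof (rule card_inj_on_le)
  define F where "F f = {i. i < 2*m \<and> f (int (Suc i)) = 1}" for f :: "int \<Rightarrow> rat"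
  let ?q = "Suc (2*m)" and ?V = "vanishing_erdos_functions (Suc (2*m))"
  have sg: "f (int (Suc i)) = (if i \<in> F f then 1 else -1)"
    if "erdos_function ?q f" "i < 2*m" for f i
    using erdos_function_at_nonmultiple[OF that(1) not_dvd_below[OF that(2)]] that(2)
    by (auto simp: F_def)
  show "inj_on F ?V"
  proof (rule inj_onI, rule ext)
    fix f g n assume "f \<in> ?V" "g \<in> ?V" and FF: "F f = F g"
    then have f: "erdos_function ?q f" and g: "erdos_function ?q g"
      by (auto simp: vanishing_erdos_functions_def erdos_functions_def)
    show "f n = g n"
    proof (cases "int ?q dvd n")
      case True
      then show ?thesis using f g erdos_function_at_multiple by metis
    next
      case False
      \<comment> \<open>Off multiples of \<open>?q\<close> the residue lies in 1, ..., 2m, so the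
        shift by 1 lands below \<open>2*m\<close>.\<close>
      define i where "i = nat (n mod int ?q) - 1"
      have "n mod int ?q \<noteq> 0" using False by (simp add: dvd_eq_mod_eq_0 del: of_nat_Suc)
      moreover have "0 \<le> n mod int ?q" "n mod int ?q < int ?q" by simp_all
      ultimately have i: "n mod int ?q = int (Suc i)" "i < 2*m" unfolding i_def by linarith+
      have "f (int (Suc i)) = g (int (Suc i))" using sg[OF f i(2)] sg[OF g i(2)] FF by simp
      then show ?thesis using erdos_function_mod[OF f, of n] erdos_function_mod[OF g, of n] i by metis
    qed
  qed
  show "F ` ?V \<subseteq> {S. S \<subseteq> {..<2*m} \<and> card S = m \<and> sum w S = (\<Sum>i<2*m. w i) / 2}"
  proof (rule image_subsetI)
    fix f assume "f \<in> ?V"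
    then have f: "erdos_function ?q f" and L: "L1 f = 0"
      by (auto simp: vanishing_erdos_functions_def erdos_functions_def)
    \<comment> \<open>Index \<open>2*m\<close> stands for the argument \<open>?q\<close>; this value
      removes it from sums over a full period.\<close>
    have last: "f (int ?q) = 0" using f by (rule erdos_function_at_multiple) simp
    have sub: "F f \<subseteq> {..<2*m}" by (auto simp: F_def)
    \<comment> \<open>Used twice: constant weight 1 gives the cardinality, weight \<open>w\<close>
      gives the condition from \<open>L1\<close>.\<close>
    have weighted: "(\<Sum>i<2*m. real_of_rat (f (int (Suc i))) * u i) = 2 * sum u (F f) - (\<Sum>i<2*m. u i)"
      for u :: "nat \<Rightarrow> real"
    proof -
      have "(\<Sum>i<2*m. real_of_rat (f (int (Suc i))) * u i)
          = (\<Sum>i<2*m. 2 * (if i \<in> F f then u i else 0) - u i)"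
        by (intro sum.cong) (simp_all add: sg[OF f] del: of_nat_Suc)
      also have "\<dots> = 2 * (\<Sum>i\<in>{..<2*m} \<inter> F f. u i) - (\<Sum>i<2*m. u i)"
        by (simp add: sum_subtractf sum_distrib_left [symmetric] sum.inter_restrict)
      finally show ?thesis using sub by (simp add: Int_absorb1)
    qed
    have "(\<Sum>i<2*m. f (int (Suc i))) = 0"
      using sum_erdos_function[OF f] last by (simp del: of_nat_Suc)
    then have "(\<Sum>i<2*m. real_of_rat (f (int (Suc i)))) = 0"
      by (metis of_rat_0 of_rat_sum)
    then have "card (F f) = m" using weighted[of "\<lambda>_. 1"] by simp
    moreover have "(\<Sum>i<?q. real_of_rat (f (int (Suc i))) * w i) = 0"
      using L L1_eq_sum_Digamma[OF f] by (simp add: w_def)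
    then have "(\<Sum>i<2*m. real_of_rat (f (int (Suc i))) * w i) = 0"
      using last by (simp del: of_nat_Suc)
    then have "sum w (F f) = (\<Sum>i<2*m. w i) / 2" using weighted[of w] by simp
    ultimately show "F f \<in> {S. S \<subseteq> {..<2*m} \<and> card S = m \<and> sum w S = (\<Sum>i<2*m. w i) / 2}"
      using sub by simp
  qed
qed simp

text \<open>The encoding read backwards: giving sign 1 on an m-subset of the 2m nonzero residues and
  -1 on the others balances the signs, and different subsets give different functions.\<close>

lemma card_erdos_functions_ge: "2*m choose m \<le> card (erdos_functions (Suc (2*m)))"
proof -
  let ?q = "Suc (2*m)"
  let ?B = "{S. S \<subseteq> {..<2*m} \<and> card S = m}"
  define G where "G S n = (if int ?q dvd n then 0 else if nat (n mod int ?q) - 1 \<in> S then 1 else -1 :: rat)"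
    for S n
  have val: "G S (int (Suc i)) = (if i \<in> S then 1 else -1)" if "i < 2*m" for S i
  proof -
    have "int (Suc i) mod int ?q = int (Suc i)" using that by simp
    then have "nat (int (Suc i) mod int ?q) - 1 = i" by simp
    then show ?thesis using not_dvd_below[OF that] by (simp only: G_def if_False)
  qed
  have "card ?B \<le> card (erdos_functions ?q)"
  proof (rule card_inj_on_le)
    show "inj_on G ?B"
    proof (rule inj_onI, rule set_eqI)
      fix S T i assume S: "S \<in> ?B" and T: "T \<in> ?B" and G: "G S = G T"
      show "i \<in> S \<longleftrightarrow> i \<in> T"
      proof (cases "i < 2*m")
        case True
        have "G S (int (Suc i)) = G T (int (Suc i))" using G by simp
        then show ?thesis unfolding val[OF True] by (simp split: if_splits)
      qed (use S T in auto)
    qed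
    show "G ` ?B \<subseteq> erdos_functions ?q"
    proof (rule image_subsetI)
      fix S assume S: "S \<in> ?B"
      have "(\<Sum>a = 1..int ?q. G S a) = (\<Sum>k<?q. G S (int (Suc k)))"
        by (rule sum.reindex_bij_witness[where j = "\<lambda>a. nat a - 1" and i = "\<lambda>k. int (Suc k)"]) auto
      also have "\<dots> = (\<Sum>k<2*m. G S (int (Suc k)))"
        unfolding sum.lessThan_Suc by (simp add: G_def del: of_nat_Suc)
      also have "\<dots> = (\<Sum>k<2*m. 2 * (if k \<in> S then 1 else 0) - 1)"
        by (intro sum.cong) (simp_all add: val del: of_nat_Suc)
      also have "\<dots> = 2 * (\<Sum>k\<in>{..<2*m} \<inter> S. 1) - 2 * of_nat m"
        by (simp only: sum_subtractf sum_distrib_left [symmetric] sum.inter_restrict finite_lessThan) simp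
      also have "{..<2*m} \<inter> S = S" using S by auto
      finally have "(\<Sum>a = 1..int ?q. G S a) = 0" using S by simp
      then show "G S \<in> erdos_functions ?q"
        unfolding erdos_functions_def erdos_function_def mem_Collect_eq
        by (auto simp: G_def simp del: of_nat_Suc)
    qed
  qed (rule finite_erdos_functions, simp)
  then show ?thesis using n_subsets[of "{..<2*m}" m] by simp
qed

section \<open>The bound for each modulus and the limit\<close>

text \<open>The number of m-subsets in the upper bound for the vanishing functions is absorbed by
  the lower bound for all of them, which leaves the Littlewood-Offord probability.\<close>

lemma card_vanishing_le_fraction:
  assumes "odd q"
  shows "real (card (vanishing_erdos_functions q))
    \<le> real ((q div 2) choose (q div 2 div 2)) / 2 ^ (q div 2) * real (card (erdos_functions q))"
proof -
  define m where "m = q div 2"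
  have q: "q = Suc (2*m)" using assms by (simp add: m_def)
  define w where "w i = Digamma (real (Suc i) / real (Suc (2*m)))" for i
  \<comment> \<open>The coefficients are distinct because Digamma is strictly increasing on the
    positive reals.\<close>
  have "strict_mono w"
    unfolding w_def by (intro strict_monoI Digamma_real_strict_mono) (auto simp: divide_strict_right_mono)
  then have inj: "inj_on w {..<2*m}" using strict_mono_imp_inj_on inj_on_subset by blast
  have "card (vanishing_erdos_functions q) * 2 ^ m
      \<le> card {S. S \<subseteq> {..<2*m} \<and> card S = m \<and> sum w S = (\<Sum>i<2*m. w i) / 2} * 2 ^ m"
    unfolding q w_def by (intro mult_le_mono1 card_vanishing_erdos_functions_le)
  also have "\<dots> \<le> (2*m choose m) * (m choose (m div 2))"
    using inj by (rule card_equal_halves_sum_le)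
  also have "\<dots> \<le> card (erdos_functions q) * (m choose (m div 2))"
    unfolding q by (intro mult_le_mono1 card_erdos_functions_ge)
  finally have "real (card (vanishing_erdos_functions q) * 2 ^ m)
      \<le> real (card (erdos_functions q) * (m choose (m div 2)))" by (rule of_nat_mono)
  then show ?thesis unfolding m_def [symmetric] by (simp add: field_simps)
qed

theorem theorem1p4:
  shows "((\<lambda>x::real.
            (\<Sum>q | 3 \<le> q \<and> real q \<le> x \<and> odd q. real (card (vanishing_erdos_functions q))) /
            (\<Sum>q | 3 \<le> q \<and> real q \<le> x \<and> odd q. real (card (erdos_functions q))))
          \<longlongrightarrow> 0) at_top"
proof -
  let ?Q = "{q::nat. 3 \<le> q \<and> odd q}"
  have "((\<lambda>x::real.
            (\<Sum>q | q \<in> ?Q \<and> real q \<le> x. real (card (vanishing_erdos_functions q))) /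
            (\<Sum>q | q \<in> ?Q \<and> real q \<le> x. real (card (erdos_functions q))))
          \<longlongrightarrow> 0) at_top"
  proof (rule sum_ratio_tendsto_0)
    show "real (card (vanishing_erdos_functions q))
        \<le> real ((q div 2) choose (q div 2 div 2)) / 2 ^ (q div 2) * real (card (erdos_functions q))"
      if "q \<in> ?Q" for q
      using that by (intro card_vanishing_le_fraction) simp
    show "1 \<le> real (card (erdos_functions q))" if "q \<in> ?Q" for q
    proof -
      define m where "m = q div 2"
      have q: "q = Suc (2*m)" using that by (simp add: m_def)
      have "0 < (2*m choose m)" by simp
      then have "1 \<le> card (erdos_functions q)"
        using card_erdos_functions_ge[of m] unfolding q by linarith
      then show ?thesis by simp
    qed
    \<comment> \<open>The bound depends on \<open>q\<close> only through \<open>q div 2\<close>, so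
      its decay follows by composition.\<close>
    have "filterlim (\<lambda>q::nat. q div 2) at_top sequentially"
      by (rule filterlim_at_top_div_const_nat) simp
    then show "(\<lambda>q. real ((q div 2) choose (q div 2 div 2)) / 2 ^ (q div 2)) \<longlonglongrightarrow> 0"
      by (rule filterlim_compose[OF middle_binomial_div_power_tendsto_0])
    show "infinite ?Q"
      unfolding infinite_nat_iff_unbounded_le
    proof
      fix k :: nat
      show "\<exists>n\<ge>k. n \<in> ?Q" by (intro exI[of _ "2*k+3"]) simp
    qed
  qed simp
  moreover have "{q. q \<in> ?Q \<and> real q \<le> x} = {q. 3 \<le> q \<and> real q \<le> x \<and> odd q}" for x by auto
  ultimately show ?thesis by simp
qed

end
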